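(* Let $G$ be a finite non-bipartite graph and let $r,s,p,q$ be non-negative integers with $\frac{2r+1}{2s+1}<\frac{2p+1}{2q+1}<og(G)$. Then $G^{\frac{2r+1}{2s+1}}<G^{\frac{2p+1}{2q+1}}$, i.e., $G^{\frac{2r+1}{2s+1}}\longrightarrow G^{\frac{2p+1}{2q+1}}$ and there is no homomorphism from $G^{\frac{2p+1}{2q+1}}$ to $G^{\frac{2r+1}{2s+1}}$.
   Context: All graphs are finite. $G\longrightarrow H$ means there is a homomorphism (adjacency-preserving vertex map) from $G$ to $H$. $og(G)$ is the odd girth of $G$. For a positive integer $k$, $G^{k}$ has vertex set $V(G)$, with $u,v$ adjacent iff there is a walk of length $k$ between them in $G$ (loops allowed). $S_t(G)$ is obtained from $G$ by replacing each edge by a path with exactly $t-1$ inner vertices, and for non-negative integers $r,s$, $G^{\frac{2r+1}{2s+1}}:=(S_{2s+1}(G))^{2r+1}$. *)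

theory Defs
  imports "Graph_Theory.Pair_Digraph" "HOL-Library.Extended_Real"
begin

text \<open>
  An undirected graph is represented by its symmetric set of arcs, so a finite simple graph is a
  \<^term>\<open>pair_graph\<close>. Powers may acquire loops and are only required to be
  \<^typ>\<open>'a pair_pre_digraph\<close>s.
\<close>

definition bipartite :: "'a pair_pre_digraph \<Rightarrow> bool" where
  "bipartite G \<longleftrightarrow>
     (\<exists>U V. pverts G = U \<union> V \<and> U \<inter> V = {} \<and> parcs G \<subseteq> U \<times> V \<union> V \<times> U)"

text \<open>
  In a symmetric digraph \<^const>\<open>pre_digraph.cycle\<close> also holds for the closed walks that traverse an
  edge back and forth. These have length 2, so they do not affect the odd girth.
  The odd girth is \<open>\<infinity>\<close> if there is no odd cycle.
\<close>

definition odd_girth :: "'a pair_pre_digraph \<Rightarrow> enat" where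
  "odd_girth G = Inf {enat (length c) | c. pre_digraph.cycle (with_proj G) c \<and> odd (length c)}"

definition hom_to :: "'a pair_pre_digraph \<Rightarrow> 'b pair_pre_digraph \<Rightarrow> bool" where
  "hom_to G H \<longleftrightarrow>
     (\<exists>f. (\<forall>v \<in> pverts G. f v \<in> pverts H) \<and> (\<forall>(u, v) \<in> parcs G. (f u, f v) \<in> parcs H))"

definition graph_power :: "'a pair_pre_digraph \<Rightarrow> nat \<Rightarrow> 'a pair_pre_digraph" where
  "graph_power G k =
     \<lparr> pverts = pverts G,
       parcs = {(u, v). \<exists>w. pre_digraph.awalk (with_proj G) u w v \<and> length w = k} \<rparr>"

text \<open>
  \<open>Inner {(u, i), (v, t - i)}\<close> is the inner vertex at distance \<open>i\<close> from \<open>u\<close> and \<open>t - i\<close> from \<open>v\<close> on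
  the path of length \<open>t\<close> that replaces the edge \<open>uv\<close>. The set makes this independent of the
  direction in which the edge is read.
\<close>

datatype 'a subdiv_vertex = Orig 'a | Inner "('a \<times> nat) set"

definition path_vertex :: "nat \<Rightarrow> 'a \<Rightarrow> 'a \<Rightarrow> nat \<Rightarrow> 'a subdiv_vertex" where
  "path_vertex t u v i =
     (if i = 0 then Orig u else if i = t then Orig v else Inner {(u, i), (v, t - i)})"

definition subdivide :: "nat \<Rightarrow> 'a pair_pre_digraph \<Rightarrow> 'a subdiv_vertex pair_pre_digraph" where
  "subdivide t G =
     \<lparr> pverts = Orig ` pverts G \<union>
         {path_vertex t u v i | u v i. (u, v) \<in> parcs G \<and> 0 < i \<and> i < t},
       parcs = {(path_vertex t u v i, path_vertex t u v (Suc i)) | u v i.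
         (u, v) \<in> parcs G \<and> i < t} \<rparr>"

definition frac_power ::
  "'a pair_pre_digraph \<Rightarrow> nat \<Rightarrow> nat \<Rightarrow> 'a subdiv_vertex pair_pre_digraph" where
  "frac_power G r s = graph_power (subdivide (2 * s + 1) G) (2 * r + 1)"

lemma path_vertex_rev: "0 < t \<Longrightarrow> i \<le> t \<Longrightarrow> path_vertex t v u (t - i) = path_vertex t u v i"
  by (auto simp: path_vertex_def)

lemma path_vertex_inner_eq_iff:
  assumes "u \<noteq> v" "0 < i" "i < t" "0 < j" "j < t"
  shows "path_vertex t u v i = path_vertex t x y j \<longleftrightarrow>
    x = u \<and> y = v \<and> j = i \<or> x = v \<and> y = u \<and> j = t - i"
  using assms by (auto simp: path_vertex_def doubleton_eq_iff)

lemma pair_graph_subdivide: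
  assumes "pair_graph G" "0 < t"
  shows "pair_graph (subdivide t G)"
proof -
  interpret pair_graph G by fact
  have fin: "finite {path_vertex t u v i | u v i. (u, v) \<in> parcs G \<and> 0 < i \<and> i < t}"
    by (rule finite_subset[of _ "(\<lambda>((u, v), i). path_vertex t u v i) ` (parcs G \<times> {..<t})"])
       (force, auto simp: pair_finite_arcs)
  have finA: "finite (parcs (subdivide t G))"
    by (rule finite_subset[of _ "(\<lambda>((u, v), i). (path_vertex t u v i, path_vertex t u v (Suc i)))
          ` (parcs G \<times> {..<t})"])
       (force simp: subdivide_def, auto simp: pair_finite_arcs)
  have sym: "(y, x) \<in> parcs (subdivide t G)" if "(x, y) \<in> parcs (subdivide t G)" for x y
  proof -
    from that obtain u v i where uv: "(u, v) \<in> parcs G" "i < t"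
      and xy: "x = path_vertex t u v i" "y = path_vertex t u v (Suc i)"
      by (auto simp: subdivide_def)
    have "(v, u) \<in> parcs G" using uv pair_sym_arcs by (auto simp: symmetric_def dest: symD)
    moreover have "y = path_vertex t v u (t - Suc i)" "x = path_vertex t v u (Suc (t - Suc i))"
      using uv xy path_vertex_rev[of t i v u] path_vertex_rev[of t "Suc i" v u] assms
      by (auto simp: Suc_diff_Suc)
    ultimately show ?thesis using uv by (force simp: subdivide_def)
  qed
  show ?thesis
  proof unfold_locales
    show "symmetric (with_proj (subdivide t G))"
      using sym by (auto simp: symmetric_def intro: symI)
    show "finite (pverts (subdivide t G))"
      using fin pair_finite_verts by (simp add: subdivide_def)
    fix e assume "e \<in> parcs (subdivide t G)"
    then obtain u v i where uv: "(u, v) \<in> parcs G" "i < t"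
      and e: "e = (path_vertex t u v i, path_vertex t u v (Suc i))"
      by (auto simp: subdivide_def)
    have mem: "path_vertex t u v j \<in> pverts (subdivide t G)" if "j \<le> t" for j
    proof (cases "j = 0 \<or> j = t")
      case True
      then show ?thesis using in_arcsD1[OF uv(1)] in_arcsD2[OF uv(1)]
        by (auto simp: subdivide_def path_vertex_def)
    next
      case False
      then have "0 < j" "j < t" using that by auto
      then show ?thesis using uv(1) unfolding subdivide_def by auto
    qed
    show "fst e \<in> pverts (subdivide t G)" "snd e \<in> pverts (subdivide t G)"
      using mem uv e by auto
    have "u \<noteq> v" using uv pair_no_loops by fastforce
    then show "fst e \<noteq> snd e"
      using uv e by (auto simp: path_vertex_def doubleton_eq_iff)
  qed (rule finA)
qed

end

theory Submission
  imports Defs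
begin

text \<open>
  Subdivision is left adjoint to the power: \<open>S\<^sub>t G \<longrightarrow> Z\<close> iff \<open>G \<longrightarrow> Z\<^sup>t\<close>. Moreover, sending each
  vertex of \<open>S\<^sub>k H\<close> to the original vertex at even distance less than \<open>k\<close> maps \<open>(S\<^sub>k H)\<^bsup>kc\<^esup>\<close> to \<open>H\<^sup>c\<close>
  for odd \<open>k\<close> and \<open>c\<close>. With \<open>a/b < c/d\<close> for the two exponents and
  \<open>Z = S\<^sub>a (S\<^sub>d G)\<close>, the walks of length \<open>ad \<le> bc\<close> in \<open>Z\<close> that replace the edges of \<open>G\<close> give
  \<open>S\<^sub>b G \<longrightarrow> Z\<^sup>c\<close>, hence \<open>(S\<^sub>b G)\<^sup>a \<longrightarrow> Z\<^bsup>ac\<^esup> \<longrightarrow> (S\<^sub>d G)\<^sup>c\<close>.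

  Conversely, with \<open>Z = S\<^sub>b (S\<^sub>d G)\<close>, a homomorphism from \<open>K = (S\<^sub>d G)\<^sup>c\<close> to \<open>(S\<^sub>b G)\<^sup>a \<longrightarrow> Z\<^bsup>ad\<^esup>\<close> yields
  \<open>S\<^sub>A K \<longrightarrow> Z\<close> with \<open>A = ad\<close>, and thus \<open>(S\<^sub>A K)\<^bsup>A+2\<^esup> \<longrightarrow> Z\<^bsup>bc\<^esup> \<longrightarrow> K\<close>. This is impossible: the bound on the
  exponent by the odd girth makes \<open>K\<close> loopless, and one may replace \<open>K\<close> by its core. A vertex of the
  core cannot be moved by an endomorphism that fixes all the others, so by induction on the distance
  from \<open>u\<close>, every point at even distance from \<open>u\<close> on a subdivided edge at \<open>u\<close> has the same image as
  \<open>u\<close>. Going one step past the far end of the edge, any two vertices with a common neighbour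
  coincide, and \<open>K\<close> is bipartite.
\<close>

section \<open>Walks and powers\<close>

lemma relpow_sym:
  fixes E :: "'a rel"
  assumes "sym E" "(x, y) \<in> E ^^ k"
  shows "(y, x) \<in> E ^^ k"
  using assms(2)
proof (induction k arbitrary: y)
  case (Suc k)
  then obtain z where "(x, z) \<in> E ^^ k" "(z, y) \<in> E" by auto
  then show ?case using Suc.IH assms(1) by (meson relpow_Suc_I2 symD)
qed auto

lemma relpow_mult: "(E ^^ k) ^^ l = E ^^ (k * l)" for E :: "'a rel"
  by (induction l) (simp_all add: relpow_add[symmetric] add.commute)

lemma relpow_first_stepE:
  fixes E :: "'a rel"
  assumes "(x, y) \<in> E ^^ k" "0 < k"
  obtains z where "(x, z) \<in> E"
proof (cases k)
  case (Suc n)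
  then have "\<exists>z. (x, z) \<in> E \<and> (z, y) \<in> E ^^ n" using assms(1) by (intro relpow_Suc_D2) simp
  then show ?thesis using that by blast
qed (use assms(2) in simp)

text \<open>The last edge of a walk can be traversed back and forth, each time adding two steps. The
  assumption \<open>0 < k\<close> supplies such an edge.\<close>

lemma relpow_extend:
  assumes "sym E" "(x, y) \<in> E ^^ k" "0 < k" "k \<le> l" "even (k + l)"
  shows "(x, y) \<in> E ^^ l"
proof -
  obtain z where z: "(z, y) \<in> E" using assms(2,3) by (cases k) auto
  then have yz: "(y, z) \<in> E" using assms(1) by (auto dest: symD)
  have "(x, y) \<in> E ^^ (k + 2 * j)" for j
  proof (induction j)
    case (Suc j)
    have "(x, y) \<in> E ^^ Suc (Suc (k + 2 * j))"
      using Suc z yz by (blast intro: relpow_Suc_I)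
    then show ?case by simp
  qed (use assms in simp)
  moreover have "\<exists>j. l = k + 2 * j" using assms(4,5) by presburger
  ultimately show ?thesis by auto
qed

lemma relpow_hom:
  assumes "(x, y) \<in> E ^^ k" "\<And>u v. (u, v) \<in> E \<Longrightarrow> (f u, f v) \<in> F"
  shows "(f x, f y) \<in> F ^^ k"
  using assms(1)
proof (induction k arbitrary: y)
  case (Suc k)
  then show ?case using assms(2) by (auto intro: relpow_Suc_I)
qed auto

lemma pair_sym_digraphD_sym: "pair_sym_digraph G \<Longrightarrow> sym (parcs G)"
  using pair_sym_digraph.pair_sym_arcs[of G] by (simp add: symmetric_def)

lemma pair_graph_imp_pair_sym_digraph: "pair_graph G \<Longrightarrow> pair_sym_digraph G"
  by (simp add: pair_graph_def pair_pseudo_graph_def)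

lemma pair_sym_digraph_imp_pair_wf_digraph: "pair_sym_digraph G \<Longrightarrow> pair_wf_digraph G"
  by (simp add: pair_sym_digraph_def)

lemma pair_graphI:
  assumes "finite (pverts G)" "parcs G \<subseteq> pverts G \<times> pverts G" "sym (parcs G)" "irrefl (parcs G)"
  shows "pair_graph G"
proof unfold_locales
  show "finite (parcs G)" using assms(1,2) finite_subset by blast
qed (use assms in \<open>auto simp: symmetric_def irrefl_def\<close>)

lemma pair_graph_sym: "pair_graph G \<Longrightarrow> sym (parcs G)"
  by (simp add: pair_graph_imp_pair_sym_digraph pair_sym_digraphD_sym)

lemma pair_graph_irrefl: "pair_graph G \<Longrightarrow> (u, u) \<notin> parcs G"
  using pair_loopfree_digraph.pair_no_loops[of G "(u, u)"]
  by (auto simp: pair_graph_def pair_digraph_def)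

lemma pair_graph_finite_verts: "pair_graph G \<Longrightarrow> finite (pverts G)"
  by (simp add: pair_graph_def pair_digraph_def pair_fin_digraph_def pair_fin_digraph_axioms_def)

text \<open>Exponent 0 gives the identity on the whole type, whereas a walk of length 0 starts at a
  vertex; the conjunct \<open>u \<in> pverts G\<close> accounts for this.\<close>

lemma awalk_iff_relpow:
  assumes "pair_wf_digraph G"
  shows "(\<exists>w. pre_digraph.awalk (with_proj G) u w v \<and> length w = k) \<longleftrightarrow>
    u \<in> pverts G \<and> (u, v) \<in> parcs G ^^ k"
proof -
  interpret pair_wf_digraph G by fact
  show ?thesis
  proof (induction k arbitrary: u)
    case (Suc k)
    have "(\<exists>w. awalk u w v \<and> length w = Suc k) \<longleftrightarrow>
        (\<exists>x. (u, x) \<in> parcs G \<and> (\<exists>w. awalk x w v \<and> length w = k))"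
    proof safe
      fix w assume w: "awalk u w v" "length w = Suc k"
      then obtain a x es where "w = (a, x) # es" by (cases w) auto
      then show "\<exists>x. (u, x) \<in> parcs G \<and> (\<exists>w. awalk x w v \<and> length w = k)"
        using w by (auto simp: awalk_Cons_iff)
    next
      fix x w assume "(u, x) \<in> parcs G" "awalk x w v" "k = length w"
      then show "\<exists>w'. awalk u w' v \<and> length w' = Suc (length w)"
        by (intro exI[of _ "(u, x) # w"]) (simp add: awalk_Cons_iff)
    qed
    also have "\<dots> \<longleftrightarrow> u \<in> pverts G \<and> (u, v) \<in> parcs G ^^ Suc k"
      unfolding Suc using relpow_Suc_D2[of u v k "parcs G"]
      by (blast intro: relpow_Suc_I2 dest: in_arcsD1 in_arcsD2)
    finally show ?case .
  qed (auto simp: awalk_Nil_iff)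
qed

lemma relpow_in_verts:
  assumes "pair_wf_digraph G" "(u, v) \<in> parcs G ^^ k" "0 < k"
  shows "u \<in> pverts G" "v \<in> pverts G"
proof -
  obtain x where "(u, x) \<in> parcs G" using assms(2,3) by (rule relpow_first_stepE)
  moreover obtain y where "(y, v) \<in> parcs G" using assms(2,3) by (cases k) auto
  ultimately show "u \<in> pverts G" "v \<in> pverts G"
    using pair_wf_digraph.in_arcsD1[OF assms(1)] pair_wf_digraph.in_arcsD2[OF assms(1)] by auto
qed

lemma pverts_graph_power [simp]: "pverts (graph_power G k) = pverts G"
  by (simp add: graph_power_def)

lemma parcs_graph_power:
  assumes "pair_wf_digraph G" "0 < k"
  shows "parcs (graph_power G k) = parcs G ^^ k"
  using relpow_in_verts[OF assms(1) _ assms(2)]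
  by (auto simp: graph_power_def awalk_iff_relpow[OF assms(1)])

lemma pair_sym_digraph_graph_power:
  assumes "pair_sym_digraph G" "0 < k"
  shows "pair_sym_digraph (graph_power G k)"
proof -
  note wf = pair_sym_digraph_imp_pair_wf_digraph[OF assms(1)]
  show ?thesis
    by unfold_locales
      (use relpow_in_verts[OF wf _ assms(2)] relpow_sym[OF pair_sym_digraphD_sym[OF assms(1)]]
        in \<open>auto simp: symmetric_def parcs_graph_power[OF wf assms(2)] intro: symI\<close>)
qed

section \<open>Homomorphisms\<close>

lemma hom_toE:
  assumes "hom_to G H"
  obtains f where "\<And>v. v \<in> pverts G \<Longrightarrow> f v \<in> pverts H"
    and "\<And>u v. (u, v) \<in> parcs G \<Longrightarrow> (f u, f v) \<in> parcs H"
proof -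
  from assms obtain f where "\<forall>v \<in> pverts G. f v \<in> pverts H"
    "\<forall>(u, v) \<in> parcs G. (f u, f v) \<in> parcs H" by (auto simp: hom_to_def)
  then show thesis by (intro that[of f]) auto
qed

lemma hom_toI:
  assumes "\<And>v. v \<in> pverts G \<Longrightarrow> f v \<in> pverts H"
    and "\<And>u v. (u, v) \<in> parcs G \<Longrightarrow> (f u, f v) \<in> parcs H"
  shows "hom_to G H"
  using assms by (auto simp: hom_to_def)

lemma hom_to_refl: "hom_to G G"
  by (rule hom_toI[of _ id]) auto

lemma hom_to_trans [trans]:
  assumes "hom_to G H" "hom_to H K"
  shows "hom_to G K"
proof -
  obtain f where "\<And>v. v \<in> pverts G \<Longrightarrow> f v \<in> pverts H"
    "\<And>u v. (u, v) \<in> parcs G \<Longrightarrow> (f u, f v) \<in> parcs H" using assms(1) by (rule hom_toE) blast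
  moreover obtain g where "\<And>v. v \<in> pverts H \<Longrightarrow> g v \<in> pverts K"
    "\<And>u v. (u, v) \<in> parcs H \<Longrightarrow> (g u, g v) \<in> parcs K" using assms(2) by (rule hom_toE) blast
  ultimately show ?thesis by (intro hom_toI[of _ "g \<circ> f"]) auto
qed

lemma hom_to_graph_power:
  assumes "hom_to G H" "pair_wf_digraph G" "pair_wf_digraph H" "0 < k"
  shows "hom_to (graph_power G k) (graph_power H k)"
proof -
  obtain f where f: "\<And>v. v \<in> pverts G \<Longrightarrow> f v \<in> pverts H"
    "\<And>u v. (u, v) \<in> parcs G \<Longrightarrow> (f u, f v) \<in> parcs H" using assms(1) by (rule hom_toE) blast
  show ?thesis
    by (rule hom_toI[of _ f]) (auto simp: parcs_graph_power assms f intro: relpow_hom)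
qed

lemma graph_power_graph_power:
  assumes "pair_sym_digraph G" "0 < k" "0 < l"
  shows "graph_power (graph_power G k) l = graph_power G (k * l)"
proof (rule pair_pre_digraph.equality)
  show "parcs (graph_power (graph_power G k) l) = parcs (graph_power G (k * l))"
    using assms by (simp add: parcs_graph_power pair_sym_digraph_imp_pair_wf_digraph
      pair_sym_digraph_graph_power relpow_mult)
qed auto

lemma hom_to_graph_power_mono:
  assumes "pair_sym_digraph G" "0 < k" "k \<le> l" "even (k + l)"
  shows "hom_to (graph_power G k) (graph_power G l)"
  using assms relpow_extend[OF pair_sym_digraphD_sym[OF assms(1)] _ assms(2-4)]
  by (intro hom_toI[of _ id]) (auto simp: parcs_graph_power pair_sym_digraph_imp_pair_wf_digraph)

text \<open>Colourings, unlike partitions, pull back along a homomorphism by mere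
  composition.\<close>

lemma bipartite_iff_two_colouring:
  assumes "pair_wf_digraph G"
  shows "bipartite G \<longleftrightarrow> (\<exists>c. \<forall>(u, v) \<in> parcs G. c u \<noteq> (c v :: bool))"
proof
  assume "bipartite G"
  then obtain U V where "U \<inter> V = {}" "parcs G \<subseteq> U \<times> V \<union> V \<times> U"
    by (auto simp: bipartite_def)
  then show "\<exists>c. \<forall>(u, v) \<in> parcs G. c u \<noteq> (c v :: bool)"
    by (intro exI[of _ "\<lambda>x. x \<in> U"]) auto
next
  assume "\<exists>c. \<forall>(u, v) \<in> parcs G. c u \<noteq> (c v :: bool)"
  then obtain c :: "_ \<Rightarrow> bool" where c: "\<And>u v. (u, v) \<in> parcs G \<Longrightarrow> c u \<noteq> c v" by auto
  show "bipartite G" unfolding bipartite_def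
    by (rule exI[of _ "{x \<in> pverts G. c x}"], rule exI[of _ "{x \<in> pverts G. \<not> c x}"])
      (use c pair_wf_digraph.wellformed'[OF assms] in fastforce)
qed

lemma bipartite_hom_to:
  assumes "hom_to G H" "bipartite H" "pair_wf_digraph G" "pair_wf_digraph H"
  shows "bipartite G"
proof -
  obtain f where f: "\<And>u v. (u, v) \<in> parcs G \<Longrightarrow> (f u, f v) \<in> parcs H"
    using assms(1) by (rule hom_toE) blast
  obtain c :: "_ \<Rightarrow> bool" where "\<And>u v. (u, v) \<in> parcs H \<Longrightarrow> c u \<noteq> c v"
    using assms(2) unfolding bipartite_iff_two_colouring[OF assms(4)] by blast
  then have "\<forall>(u, v) \<in> parcs G. (c \<circ> f) u \<noteq> (c \<circ> f) v" using f by fastforce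
  then show ?thesis unfolding bipartite_iff_two_colouring[OF assms(3)] by blast
qed

text \<open>The same colouring serves for the power: colours alternate along a walk, so they differ
  at the ends of every walk of odd length.\<close>

lemma bipartite_graph_power_odd:
  assumes "bipartite G" "pair_sym_digraph G" "odd k"
  shows "bipartite (graph_power G k)"
proof -
  note wf = pair_sym_digraph_imp_pair_wf_digraph[OF assms(2)]
  have k: "0 < k" using assms(3) by (rule odd_pos)
  obtain c :: "_ \<Rightarrow> bool" where c: "\<And>u v. (u, v) \<in> parcs G \<Longrightarrow> c u \<noteq> c v"
    using assms by (auto simp: bipartite_iff_two_colouring wf)
  have "c u = c v \<longleftrightarrow> even l" if "(u, v) \<in> parcs G ^^ l" for u v l
    using that
  proof (induction l arbitrary: v)
    case (Suc l)
    then show ?case using c by auto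
  qed auto
  then have "\<And>u v. (u, v) \<in> parcs (graph_power G k) \<Longrightarrow> c u \<noteq> c v"
    using assms(3) by (auto simp: parcs_graph_power wf k)
  then show ?thesis
    using bipartite_iff_two_colouring[OF pair_sym_digraph_imp_pair_wf_digraph[OF
      pair_sym_digraph_graph_power[OF assms(2) k]]] by auto
qed

text \<open>An odd closed walk that is not a cycle splits at a repeated vertex into two shorter
  closed walks, one of which is odd.\<close>

lemma odd_girth_le:
  assumes "pair_wf_digraph G" "(u, u) \<in> parcs G ^^ m" "odd m"
  shows "odd_girth G \<le> enat m"
proof -
  interpret pair_wf_digraph G by fact
  have "\<exists>c. cycle c \<and> odd (length c) \<and> length c \<le> length w" if "awalk u w u" "odd (length w)" for u w
    using that
  proof (induction w arbitrary: u rule: length_induct)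
    case (1 w)
    from 1(3) have "w \<noteq> []" by auto
    then obtain e es where w: "w = e # es" by (cases w) auto
    have e: "e \<in> parcs G" "u = fst e" and es: "awalk (snd e) es u"
      using 1(2) unfolding w by (auto simp: awalk_Cons_iff)
    show ?case
    proof (cases "distinct (tl (pawalk_verts u w))")
      case True
      then have "cycle w" using 1(2) \<open>w \<noteq> []\<close> unfolding cycle_def by blast
      then show ?thesis using 1(3) by blast
    next
      case False
      \<comment> \<open>Dropping the first arc discards the trivial coincidence of the first and
        last vertex of \<open>w\<close>. Hence both \<open>r\<close> and \<open>e # q @ t\<close>
        are shorter than \<open>w\<close>.\<close>
      then have "\<not> distinct (pawalk_verts (snd e) es)" by (simp add: w)
      then obtain q r t x where d: "es = q @ r @ t" "0 < length r"
        "awalk (snd e) q x" "awalk x r x" "awalk x t u"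
        using awalk_not_distinct_decomp[OF es] by blast
      show ?thesis
      proof (cases "odd (length r)")
        case True
        then have "\<exists>c. cycle c \<and> odd (length c) \<and> length c \<le> length r"
          using 1(1)[rule_format, of r x] d w by simp
        then show ?thesis using d w by force
      next
        case False
        have "awalk (snd e) (q @ t) u" using d(3,5) by (rule awalk_appendI)
        then have "awalk u (e # q @ t) u" using e by (simp add: awalk_Cons_iff)
        moreover have "odd (length (e # q @ t))" using False 1(3) d w by simp
        ultimately have "\<exists>c. cycle c \<and> odd (length c) \<and> length c \<le> length (e # q @ t)"
          using 1(1)[rule_format, of "e # q @ t" u] d w by simp
        then show ?thesis using d w by force
      qed
    qed
  qed
  moreover have "0 < m" using assms(3) by (rule odd_pos)
  ultimately obtain c where c: "cycle c" "odd (length c)" "length c \<le> m"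
    using awalk_iff_relpow[OF assms(1), of u u m] relpow_in_verts[OF assms(1,2)] assms(2,3) by blast
  have "odd_girth G \<le> enat (length c)"
    unfolding odd_girth_def by (rule Inf_lower) (use c in blast)
  also have "\<dots> \<le> enat m" using c by simp
  finally show ?thesis .
qed

section \<open>Subdivisions\<close>

lemma path_vertex_0 [simp]: "path_vertex t u v 0 = Orig u"
  by (simp add: path_vertex_def)

lemma path_vertex_end [simp]: "0 < t \<Longrightarrow> path_vertex t u v t = Orig v"
  by (simp add: path_vertex_def)

lemma path_vertex_eq_Orig: "path_vertex t u v i = Orig x \<Longrightarrow> i < t \<Longrightarrow> i = 0 \<and> x = u"
  by (auto simp: path_vertex_def split: if_splits)

lemma parcs_subdivideI:
  "(u, v) \<in> parcs G \<Longrightarrow> i < t \<Longrightarrow>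
    (path_vertex t u v i, path_vertex t u v (Suc i)) \<in> parcs (subdivide t G)"
  by (auto simp: subdivide_def)

lemma parcs_subdivideE:
  assumes "(x, y) \<in> parcs (subdivide t G)"
  obtains u v i where "(u, v) \<in> parcs G" "i < t"
    "x = path_vertex t u v i" "y = path_vertex t u v (Suc i)"
  using assms by (auto simp: subdivide_def)

lemma Orig_in_pverts_subdivide: "u \<in> pverts G \<Longrightarrow> Orig u \<in> pverts (subdivide t G)"
  by (auto simp: subdivide_def)

lemma pverts_subdivide_cases:
  assumes "x \<in> pverts (subdivide t G)"
  obtains u where "u \<in> pverts G" "x = Orig u"
  | u v i where "(u, v) \<in> parcs G" "0 < i" "i < t" "x = path_vertex t u v i"
  using assms by (auto simp: subdivide_def)

lemma path_vertex_walk: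
  assumes "(u, v) \<in> parcs G" "i + j \<le> t"
  shows "(path_vertex t u v i, path_vertex t u v (i + j)) \<in> parcs (subdivide t G) ^^ j"
  using assms(2)
proof (induction j)
  case (Suc j)
  then show ?case using parcs_subdivideI[OF assms(1), of "i + j" t] by (auto intro: relpow_Suc_I)
qed auto

lemma pair_sym_digraph_subdivide: "pair_graph G \<Longrightarrow> 0 < t \<Longrightarrow> pair_sym_digraph (subdivide t G)"
  by (simp add: pair_graph_imp_pair_sym_digraph pair_graph_subdivide)

lemma hom_to_graph_power_if_subdivide:
  assumes "hom_to (subdivide t G) Z" "0 < t" "pair_wf_digraph Z"
  shows "hom_to G (graph_power Z t)"
proof -
  obtain f where f: "\<And>v. v \<in> pverts (subdivide t G) \<Longrightarrow> f v \<in> pverts Z"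
    "\<And>u v. (u, v) \<in> parcs (subdivide t G) \<Longrightarrow> (f u, f v) \<in> parcs Z"
    using assms(1) by (rule hom_toE) blast
  show ?thesis
  proof (rule hom_toI[of _ "f \<circ> Orig"])
    fix u v assume "(u, v) \<in> parcs G"
    then have "(Orig u, Orig v) \<in> parcs (subdivide t G) ^^ t"
      using path_vertex_walk[of u v G 0 t t] assms(2) by simp
    then show "((f \<circ> Orig) u, (f \<circ> Orig) v) \<in> parcs (graph_power Z t)"
      using f(2) assms by (auto simp: parcs_graph_power intro: relpow_hom)
  qed (auto intro: f Orig_in_pverts_subdivide)
qed

text \<open>The harder half of the adjunction: the path replacing an edge is laid along a walk of
  length \<open>t\<close> in \<open>Z\<close> between the images of its ends. The inner vertices
  forget the direction of the edge, so the chosen walks must respect reversal.\<close>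

lemma hom_to_subdivide_if_graph_power:
  assumes "hom_to G (graph_power Z t)" "pair_graph G" "pair_sym_digraph Z" "0 < t"
  shows "hom_to (subdivide t G) Z"
proof -
  note wf = pair_sym_digraph_imp_pair_wf_digraph[OF assms(3)]
  note symZ = pair_sym_digraphD_sym[OF assms(3)]
  note symG = pair_graph_sym[OF assms(2)]
  obtain g where g: "\<And>v. v \<in> pverts G \<Longrightarrow> g v \<in> pverts Z"
    "\<And>u v. (u, v) \<in> parcs G \<Longrightarrow> (g u, g v) \<in> parcs Z ^^ t"
    using assms(1) by (rule hom_toE) (auto simp: parcs_graph_power wf assms(4))
  have "\<exists>f. (u, v) \<in> parcs G \<longrightarrow>
      f 0 = g u \<and> f t = g v \<and> (\<forall>i<t. (f i, f (Suc i)) \<in> parcs Z)" for u v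
    using g(2)[of u v] by (auto simp: relpow_fun_conv)
  then obtain W where W: "\<And>u v. (u, v) \<in> parcs G \<Longrightarrow>
      W u v 0 = g u \<and> W u v t = g v \<and> (\<forall>i<t. (W u v i, W u v (Suc i)) \<in> parcs Z)"
    by metis
  \<comment> \<open>The walks chosen for the two orientations of an edge need not be reverse to each other, so an
    orientation of each edge is fixed first.\<close>
  define first where "first u v \<longleftrightarrow> (SOME x. x \<in> {u, v}) = u" for u v :: 'a
  have first: "first v u \<longleftrightarrow> \<not> first u v" if "u \<noteq> v" for u v
    using that someI[of "\<lambda>x. x \<in> {u, v}" u] by (auto simp: first_def insert_commute)
  define P where "P u v i = (if first u v then W u v i else W v u (t - i))" for u v i
  have P_rev: "P v u (t - i) = P u v i" if "u \<noteq> v" "i \<le> t" for u v i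
    using that first[OF that(1)] by (simp add: P_def)
  have P: "P u v 0 = g u" "P u v t = g v" "i < t \<Longrightarrow> (P u v i, P u v (Suc i)) \<in> parcs Z"
    if uv: "(u, v) \<in> parcs G" for u v i
  proof -
    have vu: "(v, u) \<in> parcs G" using uv symG by (auto dest: symD)
    show "P u v 0 = g u" "P u v t = g v" using W[OF uv] W[OF vu] by (auto simp: P_def)
    assume "i < t"
    then have "(W v u (t - Suc i), W v u (t - i)) \<in> parcs Z"
      using W[OF vu] Suc_diff_Suc[of i t] by (metis diff_less assms(4) zero_less_Suc)
    then show "(P u v i, P u v (Suc i)) \<in> parcs Z"
      using W[OF uv] \<open>i < t\<close> symZ by (auto simp: P_def dest: symD)
  qed
  \<comment> \<open>An inner vertex has only the two readings \<open>(u, v, i)\<close> and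
    \<open>(v, u, t - i)\<close>, and \<open>P\<close> agrees on them by \<open>P_rev\<close>, so
    the choice determines the value uniquely.\<close>
  define h where "h x = (case x of Orig u \<Rightarrow> g u | Inner S \<Rightarrow>
      (SOME z. \<exists>u v i. (u, v) \<in> parcs G \<and> 0 < i \<and> i < t \<and> Inner S = path_vertex t u v i \<and> z = P u v i))"
    for x
  have h: "h (path_vertex t u v i) = P u v i" if "(u, v) \<in> parcs G" "i \<le> t" for u v i
  proof (cases "i = 0 \<or> i = t")
    case True
    then show ?thesis using P[OF that(1)] assms(4) by (auto simp: h_def)
  next
    case False
    then have i: "0 < i" "i < t" using that by auto
    then obtain S where S: "path_vertex t u v i = Inner S" by (simp add: path_vertex_def)
    have ne: "u \<noteq> v" using pair_graph_irrefl[OF assms(2)] that by auto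
    have unique: "z = P u v i" if "\<exists>x y j. (x, y) \<in> parcs G \<and> 0 < j \<and> j < t \<and>
        path_vertex t u v i = path_vertex t x y j \<and> z = P x y j" for z
    proof -
      from that obtain x y j where "0 < j" "j < t"
        "path_vertex t u v i = path_vertex t x y j" "z = P x y j" by blast
      then show ?thesis
        using path_vertex_inner_eq_iff[OF ne i, of j x y] P_rev[OF ne, of i] i by auto
    qed
    have "(SOME z. \<exists>x y j. (x, y) \<in> parcs G \<and> 0 < j \<and> j < t \<and>
        Inner S = path_vertex t x y j \<and> z = P x y j) = P u v i"
      unfolding S[symmetric] by (rule some_equality) (use that(1) i unique in blast)+
    then show ?thesis by (simp add: S h_def)
  qed
  show ?thesis
  proof (rule hom_toI[of _ h])
    fix x y assume "(x, y) \<in> parcs (subdivide t G)"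
    then show "(h x, h y) \<in> parcs Z"
      by (rule parcs_subdivideE) (simp add: h P)
  next
    fix x assume "x \<in> pverts (subdivide t G)"
    then show "h x \<in> pverts Z"
    proof (cases rule: pverts_subdivide_cases)
      case (1 u)
      then show ?thesis using g by (simp add: h_def)
    next
      case (2 u v i)
      then have "(h x, P u v (Suc i)) \<in> parcs Z" by (simp add: h P)
      then show ?thesis using pair_wf_digraph.in_arcsD1[OF wf] by blast
    qed
  qed
qed

text \<open>Here \<open>m\<close> counts the subdivided edges crossed completely. All other steps
  are undone by turning back inside an edge, so the surplus over \<open>m * t\<close>, or over
  \<open>m * t + i\<close>, is even.\<close>

lemma subdivide_walk_from_Orig:
  assumes "pair_graph H" "0 < t" "(Orig u, z) \<in> parcs (subdivide t H) ^^ L"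
  shows "(\<exists>x m. z = Orig x \<and> (u, x) \<in> parcs H ^^ m \<and> m * t \<le> L \<and> even (m * t + L)) \<or>
    (\<exists>x y i m. z = path_vertex t x y i \<and> 0 < i \<and> i < t \<and> (x, y) \<in> parcs H \<and>
      (u, x) \<in> parcs H ^^ m \<and> m * t + i \<le> L \<and> even (m * t + i + L))"
  using assms(3)
proof (induction L arbitrary: z)
  case 0
  then show ?case by (intro disjI1 exI[of _ u] exI[of _ 0]) auto
next
  case (Suc L)
  then obtain z' where z': "(Orig u, z') \<in> parcs (subdivide t H) ^^ L"
    and "(z', z) \<in> parcs (subdivide t H)" by auto
  then obtain a b j where ab: "(a, b) \<in> parcs H" "j < t"
    "z' = path_vertex t a b j" "z = path_vertex t a b (Suc j)" by (auto elim: parcs_subdivideE)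
  have forward: ?case if "(x, y) \<in> parcs H" "(u, x) \<in> parcs H ^^ m" "i < t"
    "z = path_vertex t x y (Suc i)" "m * t + i \<le> L" "even (m * t + i + L)" for x y i m
  proof (cases "Suc i = t")
    case True
    have "(u, y) \<in> parcs H ^^ Suc m" using that by (auto intro: relpow_Suc_I)
    moreover have "z = Orig y" using that True assms(2) by auto
    moreover have "Suc m * t \<le> Suc L" "even (Suc m * t + Suc L)"
      using that(5,6) True by auto
    ultimately show ?thesis by blast
  next
    case False
    then show ?thesis using that
      by (intro disjI2 exI[of _ x] exI[of _ y] exI[of _ "Suc i"] exI[of _ m]) auto
  qed
  from Suc.IH[OF z'] show ?case
  proof (elim disjE exE conjE)
    fix x m assume "z' = Orig x" "(u, x) \<in> parcs H ^^ m" "m * t \<le> L" "even (m * t + L)"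
    moreover from this have "j = 0" "a = x" using ab path_vertex_eq_Orig[of t a b j x] by auto
    ultimately show ?case using ab forward[of x b m 0] by simp
  next
    fix x y i m assume *: "z' = path_vertex t x y i" "0 < i" "i < t" "(x, y) \<in> parcs H"
      "(u, x) \<in> parcs H ^^ m" "m * t + i \<le> L" "even (m * t + i + L)"
    have ne: "x \<noteq> y" using pair_graph_irrefl[OF assms(1)] * by auto
    have "0 < j" using ab * by (cases "j = 0") (auto simp: path_vertex_def split: if_splits)
    \<comment> \<open>The last arc may come from either reading of the current edge: in the first
      case the walk advances towards \<open>y\<close>, in the second it steps back towards
      \<open>x\<close>.\<close>
    then consider "a = x" "b = y" "j = i" | "a = y" "b = x" "j = t - i"
      using path_vertex_inner_eq_iff[OF ne *(2,3), of j a b] ab * by auto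
    then show ?case
    proof cases
      case 1
      then show ?thesis using * ab forward[of x y m i] by simp
    next
      case 2
      have z: "z = path_vertex t x y (i - 1)"
        using path_vertex_rev[of t "i - 1" y x] * ab 2 assms(2) by (simp add: Suc_diff_le)
      obtain i' where i': "i = Suc i'" using *(2) gr0_conv_Suc by blast
      have len: "m * t + i' \<le> Suc L" "even (m * t + i' + Suc L)" using *(6,7) i' by simp_all
      show ?thesis
      proof (cases "i' = 0")
        case True
        then show ?thesis using *(5) len z i' by auto
      next
        case False
        then have "0 < i'" "i' < t" "z = path_vertex t x y i'" using *(3) z i' by simp_all
        then show ?thesis using *(4,5) len by blast
      qed
    qed
  qed
qed

lemma subdivide_walk_Orig_Orig:
  assumes "pair_graph H" "0 < t" "(Orig u, Orig x) \<in> parcs (subdivide t H) ^^ L"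
  obtains m where "(u, x) \<in> parcs H ^^ m" "m * t \<le> L" "even (m * t + L)"
proof -
  have "Orig x \<noteq> path_vertex t a b i" if "0 < i" "i < t" for a b i
    using that by (auto simp: path_vertex_def)
  then show thesis using subdivide_walk_from_Orig[OF assms] that by blast
qed

text \<open>A walk that meets no original vertex stays inside one subdivided edge, where each step
  changes the parity of the position.\<close>

lemma subdivide_walk_from_inner:
  assumes "pair_graph H" "0 < t" "(u, v) \<in> parcs H" "0 < j" "j < t"
    and "(path_vertex t u v j, z) \<in> parcs (subdivide t H) ^^ L"
  shows "(\<exists>w k. k \<le> L \<and> (path_vertex t u v j, Orig w) \<in> parcs (subdivide t H) ^^ k \<and>
      (Orig w, z) \<in> parcs (subdivide t H) ^^ (L - k)) \<or>
    (\<exists>i. 0 < i \<and> i < t \<and> z = path_vertex t u v i \<and> even (i + j + L))"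
  using assms(6)
proof (induction L arbitrary: z)
  case 0
  then show ?case using assms by (intro disjI2 exI[of _ j]) auto
next
  case (Suc L)
  let ?E = "parcs (subdivide t H)" and ?x = "path_vertex t u v j"
  obtain z' where z': "(?x, z') \<in> ?E ^^ L" and z'z: "(z', z) \<in> ?E" using Suc.prems by auto
  then obtain a b k where ab: "(a, b) \<in> parcs H" "k < t"
    "z' = path_vertex t a b k" "z = path_vertex t a b (Suc k)" by (auto elim: parcs_subdivideE)
  have ends: ?case if "z = Orig w" for w
    using that Suc.prems by (intro disjI1 exI[of _ w] exI[of _ "Suc L"]) auto
  from Suc.IH[OF z'] show ?case
  proof (elim disjE exE conjE)
    fix w k assume *: "k \<le> L" "(?x, Orig w) \<in> ?E ^^ k" "(Orig w, z') \<in> ?E ^^ (L - k)"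
    then have "(Orig w, z) \<in> ?E ^^ (Suc L - k)"
      using z'z by (auto simp: Suc_diff_le intro: relpow_Suc_I)
    then show ?case using * by (meson le_SucI)
  next
    fix i assume *: "0 < i" "i < t" "z' = path_vertex t u v i" "even (i + j + L)"
    have ne: "u \<noteq> v" using pair_graph_irrefl[OF assms(1)] assms by auto
    have "0 < k" using ab * by (cases "k = 0") (auto simp: path_vertex_def split: if_splits)
    then consider "a = u" "b = v" "k = i" | "a = v" "b = u" "k = t - i"
      using path_vertex_inner_eq_iff[OF ne *(1,2), of k a b] ab * by auto
    then have "\<exists>i'\<le>t. z = path_vertex t u v i' \<and> even (i' + j + Suc L)"
    proof cases
      case 1
      then show ?thesis using * ab by (intro exI[of _ "Suc i"]) auto
    next
      case 2
      then show ?thesis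
        using path_vertex_rev[of t "i - 1" v u] * ab assms(2)
        by (intro exI[of _ "i - 1"]) (auto simp: Suc_diff_le)
    qed
    then obtain i' where i': "i' \<le> t" "z = path_vertex t u v i'" "even (i' + j + Suc L)" by blast
    show ?case
    proof (cases "i' = 0 \<or> i' = t")
      case True
      then show ?thesis using i' ends assms(2) by auto
    next
      case False
      then show ?thesis using i' by auto
    qed
  qed
qed

text \<open>By parity an odd closed walk cannot stay inside one subdivided edge. It therefore meets
  an original vertex, can be rotated to start there, and then projects to \<open>H\<close>.\<close>

lemma subdivide_odd_closed_walk:
  assumes "pair_graph H" "odd t" "(z, z) \<in> parcs (subdivide t H) ^^ L" "odd L"
  obtains u m where "(u, u) \<in> parcs H ^^ m" "odd m" "m * t \<le> L"
proof -
  let ?E = "parcs (subdivide t H)"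
  have t: "0 < t" using assms(2) by (rule odd_pos)
  have "\<exists>w. (Orig w, Orig w) \<in> ?E ^^ L"
  proof -
    obtain z' where "(z, z') \<in> ?E" using assms(3) odd_pos[OF assms(4)] by (rule relpow_first_stepE)
    then obtain u v j where uv: "(u, v) \<in> parcs H" "j < t" "z = path_vertex t u v j"
      by (auto elim: parcs_subdivideE)
    show ?thesis
    proof (cases "j = 0")
      case True
      then show ?thesis using uv assms(3) by auto
    next
      case False
      have ne: "u \<noteq> v" using pair_graph_irrefl[OF assms(1)] uv by auto
      \<comment> \<open>A walk that stays inside the edge and closes up returns to position
        \<open>j\<close>, so \<open>j + j + L\<close> would be even, against
        \<open>odd L\<close>.\<close>
      have "i = j" if "path_vertex t u v j = path_vertex t u v i" "0 < i" "i < t" for i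
        using path_vertex_inner_eq_iff[OF ne, of j t i u v] that uv False ne by auto
      then obtain w k where "k \<le> L" "(z, Orig w) \<in> ?E ^^ k" "(Orig w, z) \<in> ?E ^^ (L - k)"
        using subdivide_walk_from_inner[OF assms(1) t uv(1) _ uv(2), of z L] assms(3,4) uv False
        by fastforce
      then show ?thesis using relpow_trans by (metis le_add_diff_inverse2)
    qed
  qed
  then obtain w where "(Orig w, Orig w) \<in> ?E ^^ L" by blast
  then obtain m where "(w, w) \<in> parcs H ^^ m" "m * t \<le> L" "even (m * t + L)"
    by (rule subdivide_walk_Orig_Orig[OF assms(1) t])
  then show ?thesis using that assms(2,4) by auto
qed

text \<open>As \<open>t\<close> is odd, exactly one of the distances \<open>i\<close> and
  \<open>t - i\<close> to the two ends of the edge is even.\<close>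

lemma subdivide_even_walk_to_Orig:
  assumes "pair_graph H" "odd t" "z \<in> pverts (subdivide t H)"
  obtains x j where "x \<in> pverts H" "(z, Orig x) \<in> parcs (subdivide t H) ^^ j" "even j" "j < t"
  using assms(3)
proof (cases rule: pverts_subdivide_cases)
  case (1 u)
  then show ?thesis using that[of u 0] assms(2) by (auto elim: oddE)
next
  case (2 u v i)
  have t: "0 < t" using assms(2) by (rule odd_pos)
  note wf = pair_sym_digraph_imp_pair_wf_digraph[OF pair_graph_imp_pair_sym_digraph[OF assms(1)]]
  have uv: "u \<in> pverts H" "v \<in> pverts H" using pair_wf_digraph.wellformed'[OF wf 2(1)] .
  show ?thesis
  proof (cases "even i")
    case True
    have "(Orig u, z) \<in> parcs (subdivide t H) ^^ i"
      using path_vertex_walk[OF 2(1), of 0 i t] 2 by simp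
    then show ?thesis
      using that[of u i] uv True 2 relpow_sym[OF pair_graph_sym[OF pair_graph_subdivide[OF assms(1) t]]]
      by blast
  next
    case False
    have "(z, Orig v) \<in> parcs (subdivide t H) ^^ (t - i)"
      using path_vertex_walk[OF 2(1), of i "t - i" t] 2 t by simp
    then show ?thesis using that[of v "t - i"] uv False 2 assms(2) by auto
  qed
qed

text \<open>Moving both ends of a walk to original vertices at even distance adds an even number of
  steps, fewer than \<open>2 * k\<close> in total. This is too little to cross two more edges, and
  parity excludes crossing one more.\<close>

lemma hom_to_power_subdivide_contract:
  assumes "pair_graph H" "odd k" "odd c"
  shows "hom_to (graph_power (subdivide k H) (k * c)) (graph_power H c)"
proof -
  let ?E = "parcs (subdivide k H)"
  have pos: "0 < k" "0 < c" using assms(2,3) by (auto intro: odd_pos)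
  note symH = pair_graph_sym[OF assms(1)]
  note wfH = pair_sym_digraph_imp_pair_wf_digraph[OF pair_graph_imp_pair_sym_digraph[OF assms(1)]]
  note wfS = pair_sym_digraph_imp_pair_wf_digraph[OF pair_sym_digraph_subdivide[OF assms(1) pos(1)]]
  note symS = pair_sym_digraphD_sym[OF pair_sym_digraph_subdivide[OF assms(1) pos(1)]]
  have "\<exists>x j. z \<in> pverts (subdivide k H) \<longrightarrow>
      x \<in> pverts H \<and> (z, Orig x) \<in> ?E ^^ j \<and> even j \<and> j < k" for z
    using subdivide_even_walk_to_Orig[OF assms(1,2)] by metis
  then obtain f j where f: "\<And>z. z \<in> pverts (subdivide k H) \<Longrightarrow>
      f z \<in> pverts H \<and> (z, Orig (f z)) \<in> ?E ^^ j z \<and> even (j z) \<and> j z < k"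
    by metis
  show ?thesis
  proof (rule hom_toI[of _ f])
    fix x y assume "(x, y) \<in> parcs (graph_power (subdivide k H) (k * c))"
    then have xy: "(x, y) \<in> ?E ^^ (k * c)" using pos by (simp add: parcs_graph_power wfS)
    have V: "x \<in> pverts (subdivide k H)" "y \<in> pverts (subdivide k H)"
      using relpow_in_verts[OF wfS xy] pos by auto
    have "(Orig (f x), Orig (f y)) \<in> ?E ^^ (j x + k * c + j y)"
      using f[OF V(1)] f[OF V(2)] xy by (blast intro: relpow_trans relpow_sym[OF symS])
    then obtain m where m: "(f x, f y) \<in> parcs H ^^ m" "m * k \<le> j x + k * c + j y"
      "even (m * k + (j x + k * c + j y))" by (rule subdivide_walk_Orig_Orig[OF assms(1) pos(1)])
    \<comment> \<open>Strictness leaves \<open>m = c + 1\<close> as the only value above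
      \<open>c\<close>. It has the wrong parity, since \<open>m * k\<close> is odd.\<close>
    have "m * k < k * c + 2 * k" using m(2) f[OF V(1)] f[OF V(2)] by linarith
    then have "m * k < (c + 2) * k" by (simp add: algebra_simps)
    then have "m < c + 2" by (rule mult_less_cancel2[THEN iffD1, THEN conjunct2])
    moreover have "odd m" using m(3) f[OF V(1)] f[OF V(2)] assms(2,3) by auto
    ultimately have "m \<le> c" "0 < m" using assms(3) by (presburger, auto intro: odd_pos)
    then show "(f x, f y) \<in> parcs (graph_power H c)"
      using relpow_extend[OF symH m(1)] \<open>odd m\<close> assms(3) by (simp add: parcs_graph_power wfH pos)
  qed (use f in auto)
qed

section \<open>Cores\<close>

definition induced :: "'a pair_pre_digraph \<Rightarrow> 'a set \<Rightarrow> 'a pair_pre_digraph" where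
  "induced G U = \<lparr> pverts = U, parcs = parcs G \<inter> U \<times> U \<rparr>"

lemma pair_graph_induced:
  assumes "pair_graph G" "U \<subseteq> pverts G"
  shows "pair_graph (induced G U)"
proof (rule pair_graphI)
  have "finite (pverts G)" using assms(1) by (rule pair_graph_finite_verts)
  then show "finite (pverts (induced G U))" using assms(2) by (auto simp: induced_def finite_subset)
qed (use pair_graph_sym[OF assms(1)] pair_graph_irrefl[OF assms(1)] in
    \<open>auto simp: induced_def sym_def irrefl_def\<close>)

text \<open>Choose \<open>U\<close> of least cardinality among the vertex sets whose induced
  subgraph receives a homomorphism from \<open>G\<close>. The image of \<open>U\<close> under an
  endomorphism is again such a set, so it cannot be smaller.\<close>

lemma core_exists:
  assumes "pair_graph G"
  obtains U where "U \<subseteq> pverts G" "hom_to G (induced G U)"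
    and "\<And>f. f ` U \<subseteq> U \<Longrightarrow>
      (\<And>u v. (u, v) \<in> parcs (induced G U) \<Longrightarrow> (f u, f v) \<in> parcs (induced G U)) \<Longrightarrow> inj_on f U"
proof -
  let ?P = "\<lambda>U. U \<subseteq> pverts G \<and> hom_to G (induced G U)"
  have fin: "finite (pverts G)" using assms by (rule pair_graph_finite_verts)
  note wf = pair_sym_digraph_imp_pair_wf_digraph[OF pair_graph_imp_pair_sym_digraph[OF assms]]
  have "hom_to G (induced G (pverts G))"
    using pair_wf_digraph.wellformed'[OF wf] by (intro hom_toI[of _ id]) (auto simp: induced_def)
  then have "\<exists>U. ?P U \<and> (\<forall>U'. ?P U' \<longrightarrow> card U \<le> card U')"
    by (intro ex_has_least_nat[of ?P "pverts G"]) simp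
  then obtain U where U: "?P U" and least: "\<And>U'. ?P U' \<Longrightarrow> card U \<le> card U'"
    by auto
  show ?thesis
  proof (rule that)
    fix f assume f: "f ` U \<subseteq> U"
      "\<And>u v. (u, v) \<in> parcs (induced G U) \<Longrightarrow> (f u, f v) \<in> parcs (induced G U)"
    have "hom_to (induced G U) (induced G (f ` U))"
      using f by (intro hom_toI[of _ f]) (auto simp: induced_def)
    then have "?P (f ` U)" using U f(1) hom_to_trans by blast
    then have "card U \<le> card (f ` U)" by (rule least)
    moreover have "finite U" using U fin finite_subset by blast
    ultimately show "inj_on f U" by (metis card_image_le eq_card_imp_inj_on le_antisym)
  qed (use U in auto)
qed

text \<open>The edges form a matching. A choice from the unordered pair \<open>{x, y}\<close>
  singles out one end of each edge, independently of how the edge is read, and this gives the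
  colouring.\<close>

lemma bipartite_if_degree_le_1:
  assumes "pair_graph G" "\<And>u v w. (u, v) \<in> parcs G \<Longrightarrow> (w, v) \<in> parcs G \<Longrightarrow> u = w"
  shows "bipartite G"
proof -
  note wf = pair_sym_digraph_imp_pair_wf_digraph[OF pair_graph_imp_pair_sym_digraph[OF assms(1)]]
  define c where "c x \<longleftrightarrow> (\<exists>y. (x, y) \<in> parcs G \<and> (SOME z. z \<in> {x, y}) = x)" for x
  have c: "c u \<longleftrightarrow> (SOME z. z \<in> {u, v}) = u" if "(u, v) \<in> parcs G" for u v
    using that assms(2) pair_graph_sym[OF assms(1)] unfolding c_def by (metis symD)
  have "c u \<noteq> c v" if uv: "(u, v) \<in> parcs G" for u v
  proof -
    have "(v, u) \<in> parcs G" using uv pair_graph_sym[OF assms(1)] by (auto dest: symD)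
    moreover have "u \<noteq> v" using uv pair_graph_irrefl[OF assms(1)] by auto
    moreover have "(SOME z. z \<in> {u, v}) \<in> {u, v}" by (rule someI[of _ u]) simp
    ultimately show ?thesis using c[of u v] c[of v u] uv by (auto simp: insert_commute)
  qed
  then show ?thesis by (auto simp: bipartite_iff_two_colouring[OF wf])
qed

text \<open>This is the source of strictness: \<open>K\<close> maps to the power with exponent
  \<open>A\<close>, while already the next odd exponent \<open>A + 2\<close> rules out a
  homomorphism back to \<open>K\<close>.\<close>

lemma not_hom_to_power_subdivide:
  assumes "pair_graph K" "\<not> bipartite K" "odd A"
  shows "\<not> hom_to (graph_power (subdivide A K) (A + 2)) K"
proof
  assume hom: "hom_to (graph_power (subdivide A K) (A + 2)) K"
  have A: "0 < A" using assms(3) by (rule odd_pos)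
  obtain U where U: "U \<subseteq> pverts K" "hom_to K (induced K U)" and core:
    "\<And>f. f ` U \<subseteq> U \<Longrightarrow> (\<And>u v. (u, v) \<in> parcs (induced K U) \<Longrightarrow>
      (f u, f v) \<in> parcs (induced K U)) \<Longrightarrow> inj_on f U"
    using core_exists[OF assms(1)] by blast
  define R where "R = induced K U"
  have R: "pair_graph R" unfolding R_def by (rule pair_graph_induced) fact+
  have UR: "pverts R = U" by (simp add: R_def induced_def)
  note symR = pair_graph_sym[OF R] and irreflR = pair_graph_irrefl[OF R]
  have wfR: "pair_wf_digraph R" and wfK: "pair_wf_digraph K"
    using R assms(1) by (simp_all add: pair_sym_digraph_imp_pair_wf_digraph pair_graph_imp_pair_sym_digraph)
  let ?E = "parcs (subdivide A R)"
  have S: "pair_sym_digraph (subdivide A R)" "pair_sym_digraph (subdivide A K)"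
    using R assms(1) A by (simp_all add: pair_sym_digraph_subdivide)
  note wfS = S[THEN pair_sym_digraph_imp_pair_wf_digraph]
  note symS = pair_sym_digraphD_sym[OF S(1)]
  \<comment> \<open>The inclusion of the core lifts to the subdivisions through the adjunction,
    which transfers the assumed homomorphism from \<open>K\<close> to \<open>R\<close>.\<close>
  have "hom_to R K" using U(1) by (intro hom_toI[of _ id]) (auto simp: R_def induced_def)
  also have "hom_to K (graph_power (subdivide A K) A)"
    by (rule hom_to_graph_power_if_subdivide[OF hom_to_refl A wfS(2)])
  finally have "hom_to (subdivide A R) (subdivide A K)"
    by (rule hom_to_subdivide_if_graph_power[OF _ R S(2) A])
  then have "hom_to (graph_power (subdivide A R) (A + 2)) (graph_power (subdivide A K) (A + 2))"
    by (rule hom_to_graph_power[OF _ wfS]) simp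
  also note hom
  also have "hom_to K R" using U(2) by (simp add: R_def)
  finally obtain \<rho> where \<rho>V: "\<And>x. x \<in> pverts (subdivide A R) \<Longrightarrow> \<rho> x \<in> U"
    and \<rho>: "\<And>x y. (x, y) \<in> ?E ^^ (A + 2) \<Longrightarrow> (\<rho> x, \<rho> y) \<in> parcs R"
    by (rule hom_toE) (auto simp add: parcs_graph_power wfS UR simp del: relpow.simps)
  define \<alpha> where "\<alpha> u = \<rho> (Orig u)" for u
  have \<alpha>V: "\<alpha> u \<in> U" if "u \<in> U" for u
    using that \<rho>V Orig_in_pverts_subdivide[of u R A] by (simp add: \<alpha>_def UR)
  have edge: "(Orig u, Orig v) \<in> ?E ^^ A" if "(u, v) \<in> parcs R" for u v
    using path_vertex_walk[OF that, of 0 A A] A by simp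
  have \<alpha>: "(\<alpha> u, \<alpha> v) \<in> parcs R" if "(u, v) \<in> parcs R" for u v
    unfolding \<alpha>_def using relpow_extend[OF symS edge[OF that] A, of "A + 2"] by (intro \<rho>) simp
  have inj_\<alpha>: "inj_on \<alpha> U"
    by (rule core) (use \<alpha> \<alpha>V in \<open>auto simp: R_def\<close>)
  \<comment> \<open>The redefined map is again an endomorphism of the core, because \<open>x\<close>
    is adjacent to the images of all neighbours of \<open>u\<close>.\<close>
  have rigid: "inj_on (\<alpha>(u := x)) U"
    if "u \<in> U" "x \<in> U" "\<And>z. (u, z) \<in> parcs R \<Longrightarrow> (x, \<alpha> z) \<in> parcs R" for u x
  proof (rule core)
    show "\<alpha>(u := x) ` U \<subseteq> U" using that \<alpha>V by auto
    fix a b assume "(a, b) \<in> parcs (induced K U)"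
    then have "(a, b) \<in> parcs R" "(b, a) \<in> parcs R" using symR by (auto simp: R_def dest: symD)
    then have "((\<alpha>(u := x)) a, (\<alpha>(u := x)) b) \<in> parcs R"
      using that(3)[of b] symD[OF symR that(3)[of a]] \<alpha>[of a b] irreflR by auto
    then show "((\<alpha>(u := x)) a, (\<alpha>(u := x)) b) \<in> parcs (induced K U)" by (simp add: R_def)
  qed
  have finU: "finite U" using pair_graph_finite_verts[OF R] by (simp add: UR)
  \<comment> \<open>Both \<open>\<alpha>\<close> and \<open>\<alpha>(u := x)\<close> are
    permutations of the finite set \<open>U\<close>. They agree off \<open>u\<close>, hence also at
    \<open>u\<close>.\<close>
  have rigid_eq: "x = \<alpha> u"
    if "u \<in> U" "x \<in> U" "\<And>z. (u, z) \<in> parcs R \<Longrightarrow> (x, \<alpha> z) \<in> parcs R" for u x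
  proof -
    have "(\<alpha>(u := x)) ` U = U"
      using endo_inj_surj[OF finU _ rigid[OF that]] that \<alpha>V by auto
    then have "\<alpha> u \<in> (\<alpha>(u := x)) ` U" using \<alpha>V[OF that(1)] by simp
    then obtain w where w: "w \<in> U" "\<alpha> u = (\<alpha>(u := x)) w" by blast
    then show ?thesis using inj_\<alpha> that(1) by (cases "w = u") (auto dest: inj_onD)
  qed
  have to_Orig: "(path_vertex A u v i, Orig u) \<in> ?E ^^ i" if "(u, v) \<in> parcs R" "i \<le> A" for u v i
    using path_vertex_walk[OF that(1), of 0 i A] that relpow_sym[OF symS] by auto
  \<comment> \<open>The point \<open>2i + 2\<close> away from \<open>u\<close> is joined by a walk of length \<open>A + 2\<close> to the points \<open>2i\<close> away
    from the neighbours of \<open>u\<close>, hence its image is adjacent to the images of these neighbours.\<close>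
  have along: "\<rho> (path_vertex A u v (2 * i)) = \<alpha> u" if "(u, v) \<in> parcs R" "2 * i < A" for u v i
    using that
  proof (induction i arbitrary: u v)
    case 0
    then show ?case by (simp add: \<alpha>_def)
  next
    case (Suc i)
    let ?p = "path_vertex A u v (2 * Suc i)"
    have near: "(\<rho> ?p, \<alpha> z) \<in> parcs R" if uz: "(u, z) \<in> parcs R" for z
    proof -
      have zu: "(z, u) \<in> parcs R" using uz symR by (auto dest: symD)
      have "path_vertex A u z (A - 2 * i) = path_vertex A z u (2 * i)"
        using path_vertex_rev[of A "2 * i" u z] A Suc.prems by simp
      then have "(Orig u, path_vertex A z u (2 * i)) \<in> ?E ^^ (A - 2 * i)"
        using path_vertex_walk[OF uz, of 0 "A - 2 * i" A] by simp
      moreover have "(?p, Orig u) \<in> ?E ^^ (2 * Suc i)" using Suc.prems by (intro to_Orig) auto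
      ultimately have "(?p, path_vertex A z u (2 * i)) \<in> ?E ^^ (2 * Suc i + (A - 2 * i))"
        by (blast intro: relpow_trans)
      moreover have "2 * Suc i + (A - 2 * i) = A + 2" using Suc.prems by simp
      ultimately have "(\<rho> ?p, \<rho> (path_vertex A z u (2 * i))) \<in> parcs R" using \<rho> by metis
      then show ?thesis using Suc.IH[OF zu] Suc.prems by simp
    qed
    have "\<rho> ?p \<in> U" using near[OF Suc.prems(1)] by (auto simp: R_def induced_def)
    moreover have "u \<in> U" using Suc.prems(1) by (auto simp: R_def induced_def)
    ultimately show ?case using near by (intro rigid_eq)
  qed
  \<comment> \<open>As \<open>A\<close> is odd, the point next to \<open>v\<close> on the edge lies
    at the even distance \<open>A - 1\<close> from \<open>u\<close>, within reach of
    \<open>along\<close>.\<close>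
  have last: "\<rho> (path_vertex A v u 1) = \<alpha> u" if "(u, v) \<in> parcs R" for u v
  proof -
    have "path_vertex A v u 1 = path_vertex A u v (A - 1)"
      using path_vertex_rev[of A 1 u v] A by simp
    moreover have "\<exists>i. A - 1 = 2 * i \<and> 2 * i < A" using assms(3) by (auto elim: oddE)
    ultimately show ?thesis using along[OF that] by metis
  qed
  have "u = w" if uv: "(u, v) \<in> parcs R" and wv: "(w, v) \<in> parcs R" for u v w
  proof (rule ccontr)
    assume "u \<noteq> w"
    have vu: "(v, u) \<in> parcs R" and vw: "(v, w) \<in> parcs R" using uv wv symR by (auto dest: symD)
    have in_U: "u \<in> U" "w \<in> U" using uv wv by (auto simp: R_def induced_def)
    \<comment> \<open>Start one step from \<open>v\<close> towards \<open>w\<close>, step to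
      \<open>v\<close>, cross the edge to \<open>u\<close> and take one step towards
      \<open>z\<close>: the length is \<open>A + 2\<close>, and by \<open>last\<close> the ends have
      images \<open>\<alpha> w\<close> and \<open>\<alpha> z\<close>.\<close>
    have "(\<alpha> w, \<alpha> z) \<in> parcs R" if uz: "(u, z) \<in> parcs R" for z
    proof -
      have "(z, u) \<in> parcs R" using uz symR by (auto dest: symD)
      moreover have "(path_vertex A v w 1, Orig v) \<in> ?E ^^ 1" using to_Orig[OF vw, of 1] A by simp
      moreover have "(Orig u, path_vertex A u z 1) \<in> ?E ^^ 1"
        using path_vertex_walk[OF uz, of 0 1 A] A by simp
      ultimately have "(path_vertex A v w 1, path_vertex A u z 1) \<in> ?E ^^ (1 + A + 1)"
        using edge[OF vu] by (blast intro: relpow_trans)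
      then have "(\<rho> (path_vertex A v w 1), \<rho> (path_vertex A u z 1)) \<in> parcs R"
        by (intro \<rho>) simp
      then show ?thesis using last[OF wv] last[of z u] \<open>(z, u) \<in> parcs R\<close> by simp
    qed
    \<comment> \<open>This map takes the value \<open>\<alpha> w\<close> at both \<open>u\<close>
      and \<open>w\<close>.\<close>
    then have "inj_on (\<alpha>(u := \<alpha> w)) U" using in_U \<alpha>V by (intro rigid) auto
    then show False using in_U \<open>u \<noteq> w\<close> by (auto dest!: inj_onD[of _ _ u w])
  qed
  then have "bipartite R" by (rule bipartite_if_degree_le_1[OF R])
  then show False using assms(2) bipartite_hom_to[OF \<open>hom_to K R\<close>] wfK wfR by blast
qed

section \<open>Comparison of fractional powers\<close>

text \<open>By the adjunction it suffices to map \<open>G\<close> to the power of the double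
  subdivision with exponent \<open>c * b\<close>. An edge of \<open>G\<close> becomes a walk of
  length \<open>k * d\<close> there, which backtracking extends to length
  \<open>c * b\<close>.\<close>

lemma hom_to_subdivide_interchange:
  assumes "pair_graph G" "0 < b" "0 < d" "0 < k"
    and "k * d \<le> b * c" "even (k * d + b * c)" "0 < c"
  shows "hom_to (subdivide b G) (graph_power (subdivide k (subdivide d G)) c)"
proof -
  let ?Z = "subdivide k (subdivide d G)"
  have Sd: "pair_graph (subdivide d G)" by (rule pair_graph_subdivide) fact+
  have Z: "pair_sym_digraph ?Z" using Sd assms(4) by (rule pair_sym_digraph_subdivide)
  note wfZ = pair_sym_digraph_imp_pair_wf_digraph[OF Z]
  note Zk = pair_sym_digraph_graph_power[OF Z assms(4)]
  have "hom_to (subdivide d G) (graph_power ?Z k)"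
    by (rule hom_to_graph_power_if_subdivide[OF hom_to_refl assms(4) wfZ])
  then have "hom_to G (graph_power (graph_power ?Z k) d)"
    by (rule hom_to_graph_power_if_subdivide[OF _ assms(3) pair_sym_digraph_imp_pair_wf_digraph[OF Zk]])
  also have "graph_power (graph_power ?Z k) d = graph_power ?Z (k * d)"
    using Z assms by (intro graph_power_graph_power)
  also have "hom_to (graph_power ?Z (k * d)) (graph_power ?Z (c * b))"
    using assms by (intro hom_to_graph_power_mono[OF Z]) (auto simp: mult.commute)
  also have "graph_power ?Z (c * b) = graph_power (graph_power ?Z c) b"
    using Z assms by (intro graph_power_graph_power[symmetric])
  finally show ?thesis
    by (rule hom_to_subdivide_if_graph_power[OF _ assms(1) pair_sym_digraph_graph_power[OF Z assms(7)] assms(2)])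
qed

lemma hom_to_power_subdivide_interchange:
  assumes "pair_graph G" "0 < b" "0 < d" "0 < k"
    and "k * d \<le> b * c" "even (k * d + b * c)" "0 < c" "0 < a"
  shows "hom_to (graph_power (subdivide b G) a) (graph_power (subdivide k (subdivide d G)) (c * a))"
proof -
  let ?Z = "subdivide k (subdivide d G)"
  have Z: "pair_sym_digraph ?Z"
    using assms by (intro pair_sym_digraph_subdivide pair_graph_subdivide)
  have "hom_to (graph_power (subdivide b G) a) (graph_power (graph_power ?Z c) a)"
    using assms Z by (intro hom_to_graph_power hom_to_subdivide_interchange
      pair_sym_digraph_imp_pair_wf_digraph pair_sym_digraph_subdivide pair_sym_digraph_graph_power
      pair_graph_subdivide)
  then show ?thesis using Z assms by (simp add: graph_power_graph_power)
qed

lemma hom_to_power_subdivide_if_le: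
  assumes "pair_graph G" "odd a" "odd b" "odd c" "odd d" "a * d \<le> b * c"
  shows "hom_to (graph_power (subdivide b G) a) (graph_power (subdivide d G) c)"
proof -
  have pos: "0 < a" "0 < b" "0 < c" "0 < d" using assms by (auto intro: odd_pos)
  have "hom_to (graph_power (subdivide b G) a) (graph_power (subdivide a (subdivide d G)) (c * a))"
    using assms pos by (intro hom_to_power_subdivide_interchange) auto
  also have "hom_to \<dots> (graph_power (subdivide d G) c)"
    using hom_to_power_subdivide_contract[OF pair_graph_subdivide[OF assms(1) pos(4)] assms(2,4)]
    by (simp add: mult.commute)
  finally show ?thesis .
qed

text \<open>The hypothesis \<open>girth\<close> is the odd girth bound on \<open>c / d\<close>,
  cleared of denominators and stated for odd closed walks.\<close>

lemma not_hom_to_power_subdivide_if_less: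
  assumes "pair_graph G" "\<not> bipartite G" "odd a" "odd b" "odd c" "odd d" "a * d < b * c"
    and girth: "\<And>u m. (u, u) \<in> parcs G ^^ m \<Longrightarrow> odd m \<Longrightarrow> c < m * d"
  shows "\<not> hom_to (graph_power (subdivide d G) c) (graph_power (subdivide b G) a)"
proof
  let ?S = "subdivide d G"
  let ?K = "graph_power ?S c" and ?Z = "subdivide b ?S" and ?A = "d * a"
  assume hom: "hom_to ?K (graph_power (subdivide b G) a)"
  have pos: "0 < a" "0 < b" "0 < c" "0 < d" using assms by (auto intro: odd_pos)
  have S: "pair_graph ?S" using assms(1) pos(4) by (rule pair_graph_subdivide)
  note symS = pair_graph_imp_pair_sym_digraph[OF S]
  note wfS = pair_sym_digraph_imp_pair_wf_digraph[OF symS]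
  have Z: "pair_sym_digraph ?Z" using S pos(2) by (rule pair_sym_digraph_subdivide)
  note wfZ = pair_sym_digraph_imp_pair_wf_digraph[OF Z]
  note symK = pair_sym_digraph_graph_power[OF symS pos(3)]
  note wfK = pair_sym_digraph_imp_pair_wf_digraph[OF symK]
  have K: "pair_graph ?K"
  proof (rule pair_graphI)
    show "finite (pverts ?K)" using pair_graph_finite_verts[OF S] by simp
    show "parcs ?K \<subseteq> pverts ?K \<times> pverts ?K" using pair_wf_digraph.wellformed'[OF wfK] by auto
    show "sym (parcs ?K)" using symK by (rule pair_sym_digraphD_sym)
    \<comment> \<open>A loop of the power is a closed walk of odd length \<open>c\<close> in the
      subdivision; it projects to an odd closed walk of \<open>G\<close> that is too short.\<close>
    have "(x, x) \<notin> parcs ?S ^^ c" for x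
    proof
      assume "(x, x) \<in> parcs ?S ^^ c"
      then obtain u m where "(u, u) \<in> parcs G ^^ m" "odd m" "m * d \<le> c"
        using subdivide_odd_closed_walk[OF assms(1,6) _ assms(5)] by blast
      then show False using girth by fastforce
    qed
    then show "irrefl (parcs ?K)" by (simp add: irrefl_def parcs_graph_power wfS pos)
  qed
  \<comment> \<open>A two-colouring of \<open>?K\<close> passes to its odd power with exponent
    \<open>d\<close>, to which \<open>G\<close> maps by the adjunction.\<close>
  have nonbip: "\<not> bipartite ?K"
  proof
    assume "bipartite ?K"
    then have "bipartite (graph_power ?K d)" using symK assms(6) by (rule bipartite_graph_power_odd)
    moreover have "hom_to G (graph_power ?K d)"
    proof (rule hom_to_graph_power_if_subdivide[OF _ pos(4) wfK])
      show "hom_to ?S ?K"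
        using relpow_extend[OF pair_graph_sym[OF S], of _ _ 1 c] assms(5) pos
        by (intro hom_toI[of _ id]) (auto simp: parcs_graph_power wfS)
    qed
    ultimately show False
      using assms(1,2) bipartite_hom_to pair_sym_digraph_graph_power[OF symK pos(4)]
      by (blast intro: pair_sym_digraph_imp_pair_wf_digraph pair_graph_imp_pair_sym_digraph)
  qed
  have A: "0 < ?A" "odd ?A" using pos assms by auto
  note hom
  \<comment> \<open>The interchange is applied with \<open>k = b\<close> and \<open>c = d\<close>,
    so both lengths equal \<open>b * d\<close>.\<close>
  also have "hom_to (graph_power (subdivide b G) a) (graph_power ?Z ?A)"
    using assms pos by (intro hom_to_power_subdivide_interchange) auto
  finally have "hom_to (subdivide ?A ?K) ?Z"
    using K Z A(1) by (rule hom_to_subdivide_if_graph_power)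
  then have "hom_to (graph_power (subdivide ?A ?K) (?A + 2)) (graph_power ?Z (?A + 2))"
    using K A by (intro hom_to_graph_power wfZ pair_sym_digraph_imp_pair_wf_digraph
      pair_sym_digraph_subdivide) auto
  also have "hom_to (graph_power ?Z (?A + 2)) (graph_power ?Z (b * c))"
  proof (rule hom_to_graph_power_mono[OF Z])
    \<comment> \<open>Distinct odd numbers differ by at least 2, so the strict inequality leaves
      room for the exponent \<open>?A + 2\<close>.\<close>
    have "odd (b * c)" "?A < b * c" using assms by (auto simp: mult.commute)
    then show "?A + 2 \<le> b * c" "even (?A + 2 + b * c)" using A(2) by presburger+
  qed simp
  also have "hom_to (graph_power ?Z (b * c)) ?K"
    using S assms(4,5) by (rule hom_to_power_subdivide_contract)
  finally show False using not_hom_to_power_subdivide[OF K nonbip A(2)] by blast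
qed

theorem theorem2p7:
  fixes G :: "'a pair_pre_digraph" and r s p q :: nat
  assumes "pair_graph G"
    and "\<not> bipartite G"
    and "real (2 * r + 1) / real (2 * s + 1) < real (2 * p + 1) / real (2 * q + 1)"
    and "ereal (real (2 * p + 1) / real (2 * q + 1)) < ereal_of_enat (odd_girth G)"
  shows "hom_to (frac_power G r s) (frac_power G p q) \<and>
    \<not> hom_to (frac_power G p q) (frac_power G r s)"
proof -
  have "real (2 * r + 1) * real (2 * q + 1) < real (2 * s + 1) * real (2 * p + 1)"
    using assms(3) by (simp add: field_simps)
  then have less: "(2 * r + 1) * (2 * q + 1) < (2 * s + 1) * (2 * p + 1)"
    unfolding of_nat_mult[symmetric] of_nat_less_iff .
  have girth: "2 * p + 1 < m * (2 * q + 1)" if "(u, u) \<in> parcs G ^^ m" "odd m" for u m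
  proof -
    have "odd_girth G \<le> enat m"
      using assms(1) that by (intro odd_girth_le pair_sym_digraph_imp_pair_wf_digraph
        pair_graph_imp_pair_sym_digraph)
    then have "ereal_of_enat (odd_girth G) \<le> ereal (real m)"
      by (metis ereal_of_enat_le_iff ereal_of_enat_simps(1))
    then have "ereal (real (2 * p + 1) / real (2 * q + 1)) < ereal (real m)"
      using assms(4) by (rule less_le_trans[rotated])
    then have "real (2 * p + 1) < real m * real (2 * q + 1)" by (simp add: field_simps)
    then show ?thesis unfolding of_nat_mult[symmetric] of_nat_less_iff .
  qed
  have odd: "odd (2 * r + 1)" "odd (2 * s + 1)" "odd (2 * p + 1)" "odd (2 * q + 1)" by auto
  show ?thesis unfolding frac_power_def
  proof
    show "hom_to (graph_power (subdivide (2 * s + 1) G) (2 * r + 1))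
        (graph_power (subdivide (2 * q + 1) G) (2 * p + 1))"
      by (rule hom_to_power_subdivide_if_le[OF assms(1) odd less_imp_le[OF less]])
    show "\<not> hom_to (graph_power (subdivide (2 * q + 1) G) (2 * p + 1))
        (graph_power (subdivide (2 * s + 1) G) (2 * r + 1))"
      by (rule not_hom_to_power_subdivide_if_less[OF assms(1,2) odd less]) (rule girth)
  qed
qed

end
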